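(* Let $\psi:\mathbb{R}^d\to[0,\infty)$ be a bounded measurable function supported in the unit ball of $\mathbb{R}^d$, let $a:\mathbb{R}^d\to\mathbb{R}^d$ be a diffeomorphism, and let $K(x,y)=\psi(y-a(x))+\psi(x-a(y))$ for $x,y\in\mathbb{R}^d$. Let $J_{a^{-1}}$ denote the Jacobian (determinant) of $a^{-1}$. If $\sup_{x\in\mathbb{R}^d}|J_{a^{-1}}(x)|=M<1$, then $$\lambda_1(\mathbb{R}^d)\ge 2(1-M^{1/2})^2\int_{\mathbb{R}^d}\psi(x)\,dx.$$ If $\inf_{x\in\mathbb{R}^d}|J_{a^{-1}}(x)|=m>1$, then $$\lambda_1(\mathbb{R}^d)\ge 2(m^{1/2}-1)^2\int_{\mathbb{R}^d}\psi(x)\,dx.$$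
   Context: The first eigenvalue in the whole space associated with the kernel $K$ is $$\lambda_1(\mathbb{R}^d)=\inf_{u\in L^2(\mathbb{R}^d),\,u\neq 0}\frac{\int_{\mathbb{R}^d}\int_{\mathbb{R}^d}K(x,y)(u(x)-u(y))^2\,dx\,dy}{\int_{\mathbb{R}^d}u^2(x)\,dx}.$$ Functions are real valued. *)

theory Defs
  imports "HOL-Analysis.Analysis"
begin

text \<open>Real-valued Lebesgue measurable functions with integrable square, as functions rather than
  classes; equality in \<open>L\<^sup>2\<close> is equality almost everywhere.\<close>

definition L2 :: "('a::euclidean_space \<Rightarrow> real) set" where
  "L2 = {u. u \<in> borel_measurable lebesgue \<and> integrable lebesgue (\<lambda>x. (u x)\<^sup>2)}"

text \<open>Meant for nonnegative kernels: \<^const>\<open>ennreal\<close> truncates negative values to \<open>0\<close>. The double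
  integral may be infinite for some \<open>u\<close>, hence the values in \<open>[0, \<infinity>]\<close>; the denominator is always
  finite and nonzero.\<close>

definition first_eigenvalue :: "('a::euclidean_space \<Rightarrow> 'a \<Rightarrow> real) \<Rightarrow> ennreal" where
  "first_eigenvalue K =
    (INF u \<in> {u \<in> L2. \<not> (AE x in lebesgue. u x = 0)}.
      (\<integral>\<^sup>+ y. (\<integral>\<^sup>+ x. ennreal (K x y * (u x - u y)\<^sup>2) \<partial>lebesgue) \<partial>lebesgue)
        / ennreal (\<integral> x. (u x)\<^sup>2 \<partial>lebesgue))"

definition C1_map :: "('a::euclidean_space \<Rightarrow> 'b::euclidean_space) \<Rightarrow> bool" where
  "C1_map f \<longleftrightarrow> (\<exists>f'. (\<forall>x. (f has_derivative blinfun_apply (f' x)) (at x)) \<and> continuous_on UNIV f')"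

text \<open>Diffeomorphisms of class \<open>C\<^sup>1\<close> of the whole space; these include the smooth ones.\<close>

definition diffeomorphism :: "('a::euclidean_space \<Rightarrow> 'a) \<Rightarrow> bool" where
  "diffeomorphism a \<longleftrightarrow> bij a \<and> C1_map a \<and> C1_map (inv a)"

definition jacobian_det :: "(real ^ 'n \<Rightarrow> real ^ 'n) \<Rightarrow> real ^ 'n \<Rightarrow> real" where
  "jacobian_det f x = det (jacobian f (at x))"

end

theory Submission
  imports Defs
begin

text \<open>
  By symmetry and the substitution \<open>y = z + a x\<close>, the energy of \<open>u\<close> equals
  \<open>2 \<integral> \<psi> z \<parallel>u - u (z + a \<cdot>)\<parallel>\<^sup>2 dz\<close>. Changing variables by \<open>a\<close> shows that \<open>\<parallel>u (z + a \<cdot>)\<parallel>\<^sup>2\<close> is at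
  most \<open>M \<parallel>u\<parallel>\<^sup>2\<close>, respectively at least \<open>m \<parallel>u\<parallel>\<^sup>2\<close>, for every \<open>z\<close>, so the reverse triangle
  inequality in \<open>L\<^sup>2\<close> bounds the inner norm from below by \<open>(1 - \<surd>M) \<parallel>u\<parallel>\<close>, respectively
  \<open>(\<surd>m - 1) \<parallel>u\<parallel>\<close>. Tonelli's theorem needs Borel functions, hence the passage to Borel
  representatives of \<open>\<psi>\<close> and \<open>u\<close>.
\<close>

text \<open>The change of variables theorem of the library is restricted to well-ordered index types. A copy
  of an arbitrary finite index type that carries a well-order removes the restriction.\<close>

typedef 'a well_ordered = "UNIV :: 'a set" ..

instance well_ordered :: (finite) finite
proof
  have "(UNIV :: 'a well_ordered set) = range Abs_well_ordered"
    by (metis Rep_well_ordered_inverse surjI)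
  then show "finite (UNIV :: 'a well_ordered set)"
    by (metis finite finite_imageI)
qed

text \<open>Any injection into the naturals serves: the order pulled back along it is well-founded
  because that of \<open>nat\<close> is.\<close>

definition well_ordered_index :: "'a::finite well_ordered \<Rightarrow> nat" where
  "well_ordered_index = (SOME f. inj f)"

lemma inj_well_ordered_index: "inj well_ordered_index"
proof -
  obtain f :: "'a well_ordered \<Rightarrow> nat" where "inj f"
    using finite_imp_inj_to_nat_seg[OF finite] by blast
  then show ?thesis
    unfolding well_ordered_index_def by (rule someI[where P = inj])
qed

instantiation well_ordered :: (finite) wellorder
begin

definition "x \<le> y \<longleftrightarrow> well_ordered_index x \<le> well_ordered_index y"
definition "x < y \<longleftrightarrow> well_ordered_index x < well_ordered_index y"

instance
proof
  fix P :: "'a well_ordered \<Rightarrow> bool" and a :: "'a well_ordered"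
  assume step: "\<And>x. (\<And>y. y < x \<Longrightarrow> P y) \<Longrightarrow> P x"
  show "P a"
    by (induction a rule: measure_induct_rule[of well_ordered_index])
      (use step in \<open>auto simp: less_well_ordered_def\<close>)
qed (auto simp: less_eq_well_ordered_def less_well_ordered_def
    dest: injD[OF inj_well_ordered_index])

end

lemma bij_Rep_well_ordered: "bij Rep_well_ordered"
  by (metis Rep_well_ordered_inject Rep_well_ordered_cases UNIV_I bij_def inj_def surj_def)

section \<open>Renaming coordinates: determinants and Lebesgue measure\<close>

text \<open>The Leibniz sums match term by term: conjugation by \<open>h\<close> carries the
  permutations of one index type onto those of the other and preserves the sign.\<close>

lemma det_reindex:
  fixes A :: "real ^ 'n ^ 'n" and h :: "'m::finite \<Rightarrow> 'n"
  assumes "bij h"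
  shows "det (\<chi> i j. A $ h i $ h j) = det A"
proof -
  let ?P = "map_permutation UNIV h"
  have inj: "inj h" and UNIV: "range h = UNIV"
    using assms by (auto simp: bij_def)
  have bij: "bij_betw ?P {p. p permutes UNIV} {p. p permutes UNIV}"
  proof -
    have "?P = (\<lambda>p x. if x \<in> UNIV then h (p (inv_into UNIV h x)) else x)"
      by (auto simp: fun_eq_iff map_permutation_def restrict_id_def UNIV)
    then show ?thesis
      using bij_betw_permutations[of h UNIV UNIV] assms by simp
  qed
  have "det A = (\<Sum>p | p permutes UNIV. of_int (sign (?P p)) * (\<Prod>i\<in>UNIV. A $ i $ ?P p i))"
    unfolding det_def by (subst sum.reindex_bij_betw[OF bij, symmetric]) simp
  also have "\<dots> = (\<Sum>p | p permutes UNIV. of_int (sign p) * (\<Prod>i\<in>UNIV. A $ h i $ h (p i)))"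
  proof (rule sum.cong[OF refl])
    fix p :: "'m \<Rightarrow> 'm" assume "p \<in> {p. p permutes UNIV}"
    then have "sign (?P p) = sign p"
      by (intro sign_map_permutation) (auto simp: inj)
    moreover have "(\<Prod>i\<in>UNIV. A $ i $ ?P p i) = (\<Prod>i\<in>UNIV. A $ h i $ ?P p (h i))"
      by (rule prod.reindex_bij_betw[OF assms, symmetric])
    ultimately show "of_int (sign (?P p)) * (\<Prod>i\<in>UNIV. A $ i $ ?P p i) =
        of_int (sign p) * (\<Prod>i\<in>UNIV. A $ h i $ h (p i))"
      by (simp add: map_permutation_apply inj)
  qed
  finally show ?thesis
    by (simp add: det_def)
qed

lemma reindex_borel_measurable [measurable]:
  "(\<lambda>x. \<chi> i. x $ h i) \<in> borel_measurable (borel :: (real ^ 'n) measure)"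
  by (intro borel_measurable_continuous_onI continuous_intros)

text \<open>Lebesgue measure is determined by its values on boxes, and the preimage of a box under a
  renaming of coordinates is a box with the same side lengths in another order.\<close>

lemma lborel_distr_reindex:
  fixes h :: "'m::finite \<Rightarrow> 'n::finite"
  assumes "bij h"
  shows "distr lborel borel (\<lambda>x :: real ^ 'n. \<chi> i. x $ h i) = lborel"
proof (rule lborel_eqI[symmetric])
  fix l u :: "real ^ 'm"
  assume le: "\<And>b. b \<in> Basis \<Longrightarrow> l \<bullet> b \<le> u \<bullet> b"
  let ?g = "inv h"
  have hg: "h (?g i) = i" and gh: "?g (h j) = j" for i j
    using assms by (auto simp: bij_def surj_f_inv_f)
  have bg: "bij ?g"
    by (rule bij_imp_bij_inv[OF assms])
  have le': "l $ i \<le> u $ i" for i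
    using le[of "axis i 1"] by (auto simp: Basis_vec_def inner_axis)
  have vim: "(\<lambda>x :: real ^ 'n. \<chi> i. x $ h i) -` box l u = box (\<chi> i. l $ ?g i) (\<chi> i. u $ ?g i)"
    by (auto simp: mem_box_cart) (metis hg gh)+
  have prod: "(\<Prod>b\<in>Basis. v \<bullet> b) = (\<Prod>i\<in>UNIV. v $ i)" for v :: "real ^ 'k"
  proof -
    have "(\<Prod>b\<in>(\<lambda>i. axis i 1) ` UNIV. v \<bullet> b) = (\<Prod>i\<in>UNIV. v $ i)"
      by (subst prod.reindex) (auto simp: inner_axis inj_on_def axis_eq_axis)
    then show ?thesis
      by (simp add: Basis_vec_def UNION_singleton_eq_range)
  qed
  have "emeasure (distr lborel borel (\<lambda>x :: real ^ 'n. \<chi> i. x $ h i)) (box l u)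
      = emeasure lborel (box (\<chi> i. l $ ?g i) (\<chi> i. u $ ?g i))"
    by (subst emeasure_distr) (auto simp: vim)
  also have "\<dots> = ennreal (\<Prod>b\<in>Basis. ((\<chi> i. u $ ?g i) - (\<chi> i. l $ ?g i) :: real ^ 'n) \<bullet> b)"
    by (rule emeasure_lborel_box) (auto simp: le' Basis_vec_def inner_axis)
  also have "\<dots> = ennreal (\<Prod>i\<in>UNIV. (u - l) $ ?g i)"
    by (simp only: prod) simp
  also have "(\<Prod>i\<in>UNIV. (u - l) $ ?g i) = (\<Prod>i\<in>UNIV. (u - l) $ i)"
    by (rule prod.reindex_bij_betw[OF bg])
  finally show "emeasure (distr lborel borel (\<lambda>x :: real ^ 'n. \<chi> i. x $ h i)) (box l u)
      = ennreal (\<Prod>b\<in>Basis. (u - l) \<bullet> b)"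
    by (simp only: prod)
qed auto

section \<open>Change of variables for differentiable bijections\<close>

lemma borel_measurable_if_has_derivative:
  assumes "\<And>x. (g has_derivative g' x) (at x)"
  shows "g \<in> borel_measurable borel"
proof (rule borel_measurable_continuous_onI)
  show "continuous_on UNIV g"
    using has_derivative_continuous[OF assms] by (simp add: continuous_on_eq_continuous_at)
qed

lemma distr_density_abs_det_wellorder:
  fixes g :: "real ^ 'n::{finite,wellorder} \<Rightarrow> real ^ 'n::_"
  assumes der: "\<And>x. (g has_derivative g' x) (at x)" and "bij g"
    and J: "(\<lambda>x. det (matrix (g' x))) \<in> borel_measurable borel"
  shows "distr (density lborel (\<lambda>x. ennreal \<bar>det (matrix (g' x))\<bar>)) borel g = lborel"
proof (rule measure_eqI)
  let ?J = "\<lambda>x. \<bar>det (matrix (g' x))\<bar>"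
  have [measurable]: "?J \<in> borel_measurable borel"
    using J by measurable
  have [measurable]: "g \<in> borel_measurable borel"
    using der by (rule borel_measurable_if_has_derivative)
  fix A assume "A \<in> sets (distr (density lborel (\<lambda>x. ennreal (?J x))) borel g)"
  then have [measurable]: "A \<in> sets borel"
    by simp
  define S where "S = g -` A"
  have S [measurable]: "S \<in> sets borel"
    unfolding S_def using measurable_sets[of g borel borel A] by simp
  have gS: "g ` S = A"
    unfolding S_def using \<open>bij g\<close> by (simp add: bij_def surj_image_vimage_eq)
  have eq: "A \<in> lmeasurable \<and> measure lebesgue A = r \<longleftrightarrow> (?J has_integral r) S" for r
    unfolding gS[symmetric]
  proof (rule has_measure_differentiable_image)
    show "(g has_derivative g' x) (at x within S)" for x
      by (rule has_derivative_at_withinI[OF der])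
    show "inj_on g S"
      using \<open>bij g\<close> by (intro inj_on_subset[OF bij_is_inj subset_UNIV])
  qed simp
  define N where "N = (\<integral>\<^sup>+ x. ennreal (?J x * indicator S x) \<partial>lborel)"
  have "emeasure (distr (density lborel (\<lambda>x. ennreal (?J x))) borel g) A = N"
    unfolding N_def
    by (simp add: emeasure_distr emeasure_density S_def[symmetric] ennreal_mult' ennreal_indicator)
  moreover have "N = emeasure lborel A"
  proof (cases "A \<in> lmeasurable")
    case True
    have "(?J has_integral measure lebesgue A) S"
      using True eq by blast
    then have "N = ennreal (measure lebesgue A)"
      unfolding N_def by (subst nn_integral_has_integral_lebesgue[symmetric]) (auto simp: mult.commute)
    also have "\<dots> = emeasure lborel A"
      using emeasure_eq_measure2[OF True] by simp
    finally show ?thesis .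
  next
    case False
    \<comment> \<open>A finite \<open>N\<close> would give the Jacobian a gauge integral over
      \<open>S\<close>, and the converse direction of \<open>eq\<close> would make \<open>A\<close>
      of finite measure.\<close>
    have "N = \<infinity>"
    proof (rule ccontr)
      assume "N \<noteq> \<infinity>"
      then obtain r where r: "N = ennreal r" "0 \<le> r"
        by (cases N) auto
      have "((\<lambda>x. ?J x * indicator S x) has_integral r) UNIV"
        by (rule nn_integral_has_integral) (use r in \<open>auto simp: N_def\<close>)
      also have "(\<lambda>x. ?J x * indicator S x) = (\<lambda>x. if x \<in> S then ?J x else 0)"
        by auto
      finally have "(?J has_integral r) S"
        by (simp only: has_integral_restrict_UNIV)
      then show False
        using False eq by blast
    qed
    moreover have "emeasure lborel A = \<infinity>"
      using False by (auto simp: fmeasurable_def simp flip: less_top)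
    ultimately show ?thesis
      by simp
  qed
  ultimately show "emeasure (distr (density lborel (\<lambda>x. ennreal (?J x))) borel g) A = emeasure lborel A"
    by simp
qed simp

text \<open>Conjugating \<open>g\<close> with the renaming of coordinates moves it to a well-ordered
  index type; the renaming changes neither Lebesgue measure nor the Jacobian determinant.\<close>

lemma nn_integral_change_of_variables:
  fixes g :: "real ^ 'n \<Rightarrow> real ^ 'n" and f :: "real ^ 'n \<Rightarrow> ennreal"
  assumes der: "\<And>x. (g has_derivative g' x) (at x)" and "bij g"
    and J: "(\<lambda>x. det (matrix (g' x))) \<in> borel_measurable borel"
    and [measurable]: "f \<in> borel_measurable borel"
  shows "(\<integral>\<^sup>+ x. f x \<partial>lborel) = (\<integral>\<^sup>+ x. ennreal \<bar>det (matrix (g' x))\<bar> * f (g x) \<partial>lborel)"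
proof -
  let ?J = "\<lambda>x. det (matrix (g' x))"
  let ?R = "Rep_well_ordered :: 'n well_ordered \<Rightarrow> 'n"
  define \<Phi> where "\<Phi> = (\<lambda>x :: real ^ 'n. \<chi> i. x $ ?R i)"
  define \<Psi> where "\<Psi> = (\<lambda>y :: real ^ 'n well_ordered. \<chi> i. y $ Abs_well_ordered i)"
  have [simp]: "\<Psi> (\<Phi> x) = x" "\<Phi> (\<Psi> y) = y" for x y
    by (auto simp: \<Phi>_def \<Psi>_def vec_eq_iff Rep_well_ordered_inverse Abs_well_ordered_inverse)
  have [measurable]: "\<Phi> \<in> borel_measurable borel" "\<Psi> \<in> borel_measurable borel"
    unfolding \<Phi>_def \<Psi>_def by (rule reindex_borel_measurable)+
  have lin: "bounded_linear \<Phi>" "bounded_linear \<Psi>"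
    unfolding linear_conv_bounded_linear[symmetric] \<Phi>_def \<Psi>_def
    by (auto intro!: linearI simp: vec_eq_iff)
  have [measurable]: "g \<in> borel_measurable borel"
    using der by (rule borel_measurable_if_has_derivative)
  note J [measurable]
  have \<Phi>: "distr lborel borel \<Phi> = lborel"
    unfolding \<Phi>_def by (rule lborel_distr_reindex[OF bij_Rep_well_ordered])
  have pull: "(\<integral>\<^sup>+ y. F y \<partial>lborel) = (\<integral>\<^sup>+ x. F (\<Phi> x) \<partial>lborel)"
    if [measurable]: "F \<in> borel_measurable borel" for F
    by (subst \<Phi>[symmetric], subst nn_integral_distr) auto
  define G where "G = \<Phi> \<circ> g \<circ> \<Psi>"
  define G' where "G' = (\<lambda>y. \<Phi> \<circ> g' (\<Psi> y) \<circ> \<Psi>)"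
  have derG: "(G has_derivative G' y) (at y)" for y
    unfolding G_def G'_def
    by (intro diff_chain_at bounded_linear_imp_has_derivative lin der)
  \<comment> \<open>Rows and columns of the matrix are renamed in the same way, so
    \<open>det_reindex\<close> applies.\<close>
  have detG: "det (matrix (G' y)) = ?J (\<Psi> y)" for y
  proof -
    have "\<Psi> (axis j 1) = axis (?R j) 1" for j
      by (auto simp: \<Psi>_def axis_def vec_eq_iff Abs_well_ordered_inverse Rep_well_ordered_inverse)
    then have "matrix (G' y) = (\<chi> i j. matrix (g' (\<Psi> y)) $ ?R i $ ?R j)"
      by (simp add: matrix_def G'_def) (simp add: \<Phi>_def)
    then show ?thesis
      by (simp add: det_reindex[OF bij_Rep_well_ordered])
  qed
  have "bij G"
  proof -
    have "bij \<Phi>" "bij \<Psi>"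
      by (rule o_bij[of \<Psi>] o_bij[of \<Phi>]; simp add: fun_eq_iff)+
    then show ?thesis
      unfolding G_def using \<open>bij g\<close> by (intro bij_comp)
  qed
  have distr: "distr (density lborel (\<lambda>y. ennreal \<bar>det (matrix (G' y))\<bar>)) borel G = lborel"
    by (rule distr_density_abs_det_wellorder[OF derG \<open>bij G\<close>]) (simp add: detG)
  have "(\<integral>\<^sup>+ x. f x \<partial>lborel) = (\<integral>\<^sup>+ y. f (\<Psi> y) \<partial>lborel)"
    by (subst pull) auto
  also have "\<dots> = (\<integral>\<^sup>+ y. ennreal \<bar>?J (\<Psi> y)\<bar> * f (\<Psi> (G y)) \<partial>lborel)"
    by (subst distr[symmetric], subst nn_integral_distr)
      (auto simp: G_def detG nn_integral_density)
  also have "\<dots> = (\<integral>\<^sup>+ x. ennreal \<bar>?J x\<bar> * f (g x) \<partial>lborel)"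
    by (subst pull) (auto simp: G_def)
  finally show ?thesis .
qed

section \<open>Jacobians of diffeomorphisms and images of Lebesgue measure\<close>

text \<open>\<open>jacobian_det\<close> goes through a derivative picked by choice; uniqueness of
  derivatives identifies it with the continuous field that \<open>C1_map\<close> provides.\<close>

lemma diffeomorphism_inverse_derivative:
  fixes a :: "real ^ 'n \<Rightarrow> real ^ 'n"
  assumes "diffeomorphism a"
  obtains b' where
    "\<And>x. (inv a has_derivative blinfun_apply (b' x)) (at x)"
    "\<And>x. jacobian_det (inv a) x = det (matrix (blinfun_apply (b' x)))"
    "continuous_on UNIV b'"
proof -
  obtain b' where b': "\<And>x. (inv a has_derivative blinfun_apply (b' x)) (at x)"
      "continuous_on UNIV b'"
    using assms unfolding diffeomorphism_def C1_map_def by blast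
  show thesis
    by (rule that[OF b'(1) _ b'(2)])
      (simp add: jacobian_det_def jacobian_def frechet_derivative_at[OF b'(1), symmetric])
qed

lemma diffeomorphism_borel_measurable:
  assumes "diffeomorphism a"
  shows "a \<in> borel_measurable borel"
proof -
  obtain a' where "\<And>x. (a has_derivative blinfun_apply (a' x)) (at x)"
    using assms unfolding diffeomorphism_def C1_map_def by blast
  then show ?thesis
    by (rule borel_measurable_if_has_derivative)
qed

lemma jacobian_det_inv_borel_measurable:
  fixes a :: "real ^ 'n \<Rightarrow> real ^ 'n"
  assumes "diffeomorphism a"
  shows "jacobian_det (inv a) \<in> borel_measurable borel"
proof -
  obtain b' where b': "\<And>x. (inv a has_derivative blinfun_apply (b' x)) (at x)"
      "\<And>x. jacobian_det (inv a) x = det (matrix (blinfun_apply (b' x)))"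
      "continuous_on UNIV b'"
    using that by (rule diffeomorphism_inverse_derivative[OF assms])
  \<comment> \<open>The determinant is a polynomial in the matrix entries, which are continuous
    through \<open>b'\<close>.\<close>
  have "continuous_on UNIV (jacobian_det (inv a))"
    unfolding b'(2)[abs_def] det_def matrix_def
    by (auto intro!: continuous_intros b'(3))
  then show ?thesis
    by (rule borel_measurable_continuous_onI)
qed

text \<open>By the chain rule for \<open>a \<circ> inv a = id\<close>, the derivative matrix of
  \<open>inv a\<close> has a left inverse. The main proof uses this to get
  \<open>0 < M\<close>.\<close>

lemma jacobian_det_inv_nonzero:
  assumes "diffeomorphism a"
  shows "jacobian_det (inv a) x \<noteq> 0"
proof -
  obtain b' where b': "\<And>x. (inv a has_derivative blinfun_apply (b' x)) (at x)"
      "\<And>x. jacobian_det (inv a) x = det (matrix (blinfun_apply (b' x)))"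
      "continuous_on UNIV b'"
    using that by (rule diffeomorphism_inverse_derivative[OF assms])
  obtain a' where a': "\<And>x. (a has_derivative blinfun_apply (a' x)) (at x)"
    using assms unfolding diffeomorphism_def C1_map_def by blast
  have "a \<circ> inv a = id"
    using assms by (simp add: diffeomorphism_def bij_def surj_iff)
  then have "(id has_derivative blinfun_apply (a' (inv a x)) \<circ> blinfun_apply (b' x)) (at x)"
    by (metis a' b'(1) diff_chain_at)
  then have "blinfun_apply (a' (inv a x)) \<circ> blinfun_apply (b' x) = id"
    by (rule has_derivative_unique) (rule has_derivative_id)
  then have "matrix (blinfun_apply (a' (inv a x))) ** matrix (blinfun_apply (b' x)) = mat 1"
    by (subst matrix_compose[symmetric])
      (auto simp: blinfun.bounded_linear_right bounded_linear.linear matrix_id_mat_1)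
  then show ?thesis
    unfolding b'(2) by (metis det_I det_mul mult_zero_right zero_neq_one)
qed

text \<open>The change of variables is made with \<open>inv a\<close>, which turns
  \<open>indicator A (a x)\<close> into \<open>indicator A x\<close> and leaves the Jacobian of the
  inverse as density.\<close>

lemma distr_diffeomorphism:
  fixes a :: "real ^ 'n \<Rightarrow> real ^ 'n"
  assumes "diffeomorphism a"
  shows "distr lborel borel a = density lborel (\<lambda>x. ennreal \<bar>jacobian_det (inv a) x\<bar>)"
proof (rule measure_eqI)
  note [measurable] = diffeomorphism_borel_measurable[OF assms] jacobian_det_inv_borel_measurable[OF assms]
  obtain b' where b': "\<And>x. (inv a has_derivative blinfun_apply (b' x)) (at x)"
      "\<And>x. jacobian_det (inv a) x = det (matrix (blinfun_apply (b' x)))"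
      "continuous_on UNIV b'"
    using that by (rule diffeomorphism_inverse_derivative[OF assms])
  have "bij a"
    using assms by (simp add: diffeomorphism_def)
  fix A assume "A \<in> sets (distr lborel borel a)"
  then have [measurable]: "A \<in> sets borel"
    by simp
  have "emeasure (distr lborel borel a) A = (\<integral>\<^sup>+ x. indicator A (a x) \<partial>lborel)"
    by (subst nn_integral_indicator[symmetric], simp, subst nn_integral_distr) auto
  also have "\<dots> = (\<integral>\<^sup>+ x. ennreal \<bar>jacobian_det (inv a) x\<bar> * indicator A (a (inv a x)) \<partial>lborel)"
    unfolding b'(2)
    by (rule nn_integral_change_of_variables[OF b'(1) bij_imp_bij_inv[OF \<open>bij a\<close>]])
      (simp_all flip: b'(2))
  also have "\<dots> = emeasure (density lborel (\<lambda>x. ennreal \<bar>jacobian_det (inv a) x\<bar>)) A"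
    using \<open>bij a\<close> by (simp add: bij_def surj_f_inv_f emeasure_density)
  finally show "emeasure (distr lborel borel a) A
      = emeasure (density lborel (\<lambda>x. ennreal \<bar>jacobian_det (inv a) x\<bar>)) A" .
qed simp

lemma nn_integral_diffeomorphism:
  assumes "diffeomorphism a" and [measurable]: "f \<in> borel_measurable borel"
  shows "(\<integral>\<^sup>+ x. f (a x) \<partial>lborel) = (\<integral>\<^sup>+ x. ennreal \<bar>jacobian_det (inv a) x\<bar> * f x \<partial>lborel)"
proof -
  note [measurable] = diffeomorphism_borel_measurable[OF assms(1)]
    jacobian_det_inv_borel_measurable[OF assms(1)]
  have "(\<integral>\<^sup>+ x. f (a x) \<partial>lborel) = (\<integral>\<^sup>+ x. f x \<partial>distr lborel borel a)"
    by (subst nn_integral_distr) auto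
  then show ?thesis
    by (simp add: distr_diffeomorphism[OF assms(1)] nn_integral_density)
qed

text \<open>The image measure has a density with respect to \<open>lborel\<close>, so preimages of
  null sets under \<open>a\<close> are null. This permits replacing \<psi> by a Borel representative
  inside \<open>\<psi> (y - a x)\<close>.\<close>

lemma AE_lborel_diffeomorphism:
  fixes a :: "real ^ 'n \<Rightarrow> real ^ 'n"
  assumes "diffeomorphism a" and "AE x in lborel. P x"
  shows "AE x in lborel. P (a x)"
proof -
  have "AE x in distr lborel borel a. P x"
    unfolding distr_diffeomorphism[OF assms(1)]
    by (subst AE_density) (use assms(2) jacobian_det_inv_borel_measurable[OF assms(1)] in auto)
  then show ?thesis
    using AE_distrD[of a lborel borel P] diffeomorphism_borel_measurable[OF assms(1)] by simp
qed

section \<open>Reflections and translations\<close>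

lemma distr_lborel_const_minus:
  fixes c :: "'a::euclidean_space"
  shows "distr lborel borel (\<lambda>x. c - x) = lborel"
  by (subst lborel_affine[of "-1" c]) (auto simp: density_1)

lemma distr_lborel_minus_const:
  fixes c :: "'a::euclidean_space"
  shows "distr lborel borel (\<lambda>x. x - c) = lborel"
proof -
  have "(\<lambda>x. x - c) = (+) (- c)"
    by auto
  then show ?thesis
    by (simp only: lborel_distr_plus)
qed

lemma nn_integral_lborel_translation:
  fixes f :: "'a::euclidean_space \<Rightarrow> ennreal"
  assumes [measurable]: "f \<in> borel_measurable borel"
  shows "(\<integral>\<^sup>+ x. f (c + x) \<partial>lborel) = (\<integral>\<^sup>+ x. f x \<partial>lborel)"
  by (subst (2) lborel_distr_plus[of c, symmetric], subst nn_integral_distr) auto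

section \<open>The reverse triangle inequality for square integrals\<close>

text \<open>The two sides differ by \<open>(s * p - q)\<^sup>2 / s\<close>. Equality holds at
  \<open>q = s * p\<close>, so no constant is lost when the norms have ratio
  \<open>s\<close>.\<close>

lemma weighted_square_inequality:
  fixes p q s :: real
  assumes "0 < s"
  shows "(1 - s) * p\<^sup>2 \<le> (p - q)\<^sup>2 + (1 / s - 1) * q\<^sup>2"
proof -
  have "(p - q)\<^sup>2 + (1 / s - 1) * q\<^sup>2 - (1 - s) * p\<^sup>2 = (s * p - q)\<^sup>2 / s"
    using assms by (simp add: field_simps power2_eq_square)
  also have "\<dots> \<ge> 0"
    using assms by simp
  finally show ?thesis
    by simp
qed

text \<open>The reverse triangle inequality in \<open>L\<^sup>2\<close>, for norms that differ by a factor \<open>s\<close>. Expanding the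
  square with a weight \<open>s\<close> in Young's inequality avoids assuming that \<open>g\<close> is square integrable.\<close>

lemma nn_integral_power2_diff_ge:
  fixes f g :: "'a \<Rightarrow> real"
  assumes [measurable]: "f \<in> borel_measurable N" "g \<in> borel_measurable N"
    and fin: "(\<integral>\<^sup>+ x. ennreal ((f x)\<^sup>2) \<partial>N) < \<infinity>" and "0 < s"
    and cmp: "s \<le> 1 \<and> (\<integral>\<^sup>+ x. ennreal ((g x)\<^sup>2) \<partial>N) \<le> ennreal (s\<^sup>2) * (\<integral>\<^sup>+ x. ennreal ((f x)\<^sup>2) \<partial>N) \<or>
      1 \<le> s \<and> ennreal (s\<^sup>2) * (\<integral>\<^sup>+ x. ennreal ((f x)\<^sup>2) \<partial>N) \<le> (\<integral>\<^sup>+ x. ennreal ((g x)\<^sup>2) \<partial>N)"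
  shows "ennreal ((1 - s)\<^sup>2) * (\<integral>\<^sup>+ x. ennreal ((f x)\<^sup>2) \<partial>N) \<le> (\<integral>\<^sup>+ x. ennreal ((f x - g x)\<^sup>2) \<partial>N)"
proof -
  let ?P = "\<integral>\<^sup>+ x. ennreal ((f x)\<^sup>2) \<partial>N" and ?Q = "\<integral>\<^sup>+ x. ennreal ((g x)\<^sup>2) \<partial>N"
  let ?A = "\<integral>\<^sup>+ x. ennreal ((f x - g x)\<^sup>2) \<partial>N"
  \<comment> \<open>Subtracting the \<open>d\<close> term from both sides is legitimate because
    \<open>?P\<close> is finite by \<open>fin\<close>.\<close>
  have cancel: "ennreal ((1 - s)\<^sup>2) * ?P \<le> ?A"
    if "ennreal c * ?P \<le> ?A + ennreal d * ?P" "c = (1 - s)\<^sup>2 + d" "0 \<le> d" for c d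
  proof -
    have "ennreal ((1 - s)\<^sup>2) * ?P + ennreal d * ?P \<le> ?A + ennreal d * ?P"
      using that by (simp add: ennreal_plus distrib_right)
    then show ?thesis
      using fin by (auto simp: ennreal_mult_eq_top_iff)
  qed
  from cmp show ?thesis
  proof
    assume *: "s \<le> 1 \<and> ?Q \<le> ennreal (s\<^sup>2) * ?P"
    have d: "(1 / s - 1) * s\<^sup>2 = s - s\<^sup>2" "0 \<le> 1 / s - 1"
      using \<open>0 < s\<close> * by (auto simp: field_simps power2_eq_square)
    have "ennreal (1 - s) * ?P = (\<integral>\<^sup>+ x. ennreal ((1 - s) * (f x)\<^sup>2) \<partial>N)"
      using * by (simp add: ennreal_mult' flip: nn_integral_cmult)
    also have "\<dots> \<le> (\<integral>\<^sup>+ x. ennreal ((f x - g x)\<^sup>2 + (1 / s - 1) * (g x)\<^sup>2) \<partial>N)"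
      by (intro nn_integral_mono ennreal_leI weighted_square_inequality \<open>0 < s\<close>)
    also have "\<dots> = ?A + ennreal (1 / s - 1) * ?Q"
      using d(2) by (simp add: ennreal_plus ennreal_mult' nn_integral_add nn_integral_cmult del: diff_ge_0_iff_ge le_divide_eq_1)
    also have "\<dots> \<le> ?A + ennreal (1 / s - 1) * (ennreal (s\<^sup>2) * ?P)"
      using * by (intro add_left_mono mult_left_mono) auto
    also have "ennreal (1 / s - 1) * (ennreal (s\<^sup>2) * ?P) = ennreal (s - s\<^sup>2) * ?P"
      unfolding d(1)[symmetric] by (simp only: ennreal_mult[OF d(2) zero_le_power2] mult.assoc)
    \<comment> \<open>The constant comes out as
      \<open>(1 - s) - (s - s\<^sup>2) = (1 - s)\<^sup>2\<close>.\<close>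
    finally have "ennreal (1 - s) * ?P \<le> ?A + ennreal (s - s\<^sup>2) * ?P" .
    then show ?thesis
      by (rule cancel) (use * \<open>0 < s\<close> in \<open>auto simp: power2_eq_square algebra_simps mult_le_one\<close>)
  next
    \<comment> \<open>Here the weighted inequality is solved for the square of \<open>g x\<close>,
      since the lower bound on \<open>?Q\<close> is the information at hand; the constant is
      \<open>(s\<^sup>2 - s) - (s - 1) = (1 - s)\<^sup>2\<close>.\<close>
    assume *: "1 \<le> s \<and> ennreal (s\<^sup>2) * ?P \<le> ?Q"
    have d: "(1 - 1 / s) * s\<^sup>2 = s\<^sup>2 - s" "0 \<le> 1 - 1 / s"
      using \<open>0 < s\<close> * by (auto simp: field_simps power2_eq_square)
    have "ennreal (s\<^sup>2 - s) * ?P = ennreal (1 - 1 / s) * (ennreal (s\<^sup>2) * ?P)"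
      unfolding d(1)[symmetric] by (simp only: ennreal_mult[OF d(2) zero_le_power2] mult.assoc)
    also have "\<dots> \<le> ennreal (1 - 1 / s) * ?Q"
      using * by (intro mult_left_mono) auto
    also have "\<dots> = (\<integral>\<^sup>+ x. ennreal ((1 - 1 / s) * (g x)\<^sup>2) \<partial>N)"
      using d(2) by (simp add: ennreal_mult' nn_integral_cmult)
    also have "\<dots> \<le> (\<integral>\<^sup>+ x. ennreal ((f x - g x)\<^sup>2 + (s - 1) * (f x)\<^sup>2) \<partial>N)"
    proof (intro nn_integral_mono ennreal_leI)
      show "(1 - 1 / s) * (g x)\<^sup>2 \<le> (f x - g x)\<^sup>2 + (s - 1) * (f x)\<^sup>2" for x
        using weighted_square_inequality[OF \<open>0 < s\<close>, of "f x" "g x"] by (simp add: algebra_simps)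
    qed
    also have "\<dots> = ?A + ennreal (s - 1) * ?P"
      using * by (simp add: ennreal_plus ennreal_mult' nn_integral_add nn_integral_cmult)
    finally have "ennreal (s\<^sup>2 - s) * ?P \<le> ?A + ennreal (s - 1) * ?P" .
    then show ?thesis
      by (rule cancel) (use * in \<open>auto simp: power2_eq_square algebra_simps\<close>)
  qed
qed

section \<open>The energy and the lower bound for the eigenvalue\<close>

text \<open>The two summands of the kernel are exchanged by swapping \<open>x\<close> and
  \<open>y\<close>, so by Tonelli they contribute equally; this is the factor
  \<open>2\<close>.\<close>

lemma nn_integral_kernel_eq:
  fixes \<psi> u :: "'a::euclidean_space \<Rightarrow> real"
  assumes [measurable]: "\<psi> \<in> borel_measurable borel" "u \<in> borel_measurable borel" "a \<in> borel_measurable borel"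
    and nonneg: "\<And>x. 0 \<le> \<psi> x"
  shows "(\<integral>\<^sup>+ y. (\<integral>\<^sup>+ x. ennreal ((\<psi> (y - a x) + \<psi> (x - a y)) * (u x - u y)\<^sup>2) \<partial>lborel) \<partial>lborel)
    = 2 * (\<integral>\<^sup>+ z. ennreal (\<psi> z) * (\<integral>\<^sup>+ x. ennreal ((u x - u (z + a x))\<^sup>2) \<partial>lborel) \<partial>lborel)"
proof -
  define F where "F = (\<lambda>x y. ennreal (\<psi> (y - a x) * (u x - u y)\<^sup>2))"
  have F [measurable]: "(\<lambda>(x, y). F x y) \<in> borel_measurable (lborel \<Otimes>\<^sub>M lborel)"
      "(\<lambda>(y, x). F x y) \<in> borel_measurable (lborel \<Otimes>\<^sub>M lborel)"
    unfolding F_def by measurable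
  have "(\<integral>\<^sup>+ y. (\<integral>\<^sup>+ x. ennreal ((\<psi> (y - a x) + \<psi> (x - a y)) * (u x - u y)\<^sup>2) \<partial>lborel) \<partial>lborel)
      = (\<integral>\<^sup>+ y. (\<integral>\<^sup>+ x. F x y + F y x \<partial>lborel) \<partial>lborel)"
    by (simp add: F_def distrib_right nonneg power2_commute flip: ennreal_plus)
  also have "\<dots> = (\<integral>\<^sup>+ y. (\<integral>\<^sup>+ x. F x y \<partial>lborel) + (\<integral>\<^sup>+ x. F y x \<partial>lborel) \<partial>lborel)"
    by (intro nn_integral_cong nn_integral_add) (auto simp: F_def)
  also have "\<dots> = (\<integral>\<^sup>+ y. (\<integral>\<^sup>+ x. F x y \<partial>lborel) \<partial>lborel) + (\<integral>\<^sup>+ y. (\<integral>\<^sup>+ x. F y x \<partial>lborel) \<partial>lborel)"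
    by (intro nn_integral_add) auto
  also have "(\<integral>\<^sup>+ y. (\<integral>\<^sup>+ x. F x y \<partial>lborel) \<partial>lborel) = (\<integral>\<^sup>+ x. (\<integral>\<^sup>+ y. F x y \<partial>lborel) \<partial>lborel)"
    by (rule lborel_pair.Fubini'[OF F(1)])
  also have "\<dots> + \<dots> = 2 * (\<integral>\<^sup>+ x. (\<integral>\<^sup>+ y. F x y \<partial>lborel) \<partial>lborel)"
    by (simp add: mult_2)
  also have "(\<integral>\<^sup>+ x. (\<integral>\<^sup>+ y. F x y \<partial>lborel) \<partial>lborel)
      = (\<integral>\<^sup>+ x. (\<integral>\<^sup>+ z. ennreal (\<psi> z) * ennreal ((u x - u (z + a x))\<^sup>2) \<partial>lborel) \<partial>lborel)"
  proof (rule nn_integral_cong)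
    fix x
    have "(\<integral>\<^sup>+ y. F x y \<partial>lborel) = (\<integral>\<^sup>+ z. F x (a x + z) \<partial>lborel)"
      by (rule nn_integral_lborel_translation[symmetric]) (simp add: F_def)
    then show "(\<integral>\<^sup>+ y. F x y \<partial>lborel) = (\<integral>\<^sup>+ z. ennreal (\<psi> z) * ennreal ((u x - u (z + a x))\<^sup>2) \<partial>lborel)"
      by (simp add: F_def ennreal_mult' nonneg add.commute)
  qed
  \<comment> \<open>A second use of Tonelli frees the weight \<open>\<psi> z\<close> from the
    integral over \<open>x\<close>, leaving a squared distance for each fixed
    \<open>z\<close>.\<close>
  also have "\<dots> = (\<integral>\<^sup>+ z. (\<integral>\<^sup>+ x. ennreal (\<psi> z) * ennreal ((u x - u (z + a x))\<^sup>2) \<partial>lborel) \<partial>lborel)"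
    by (rule lborel_pair.Fubini'[symmetric]) simp
  also have "\<dots> = (\<integral>\<^sup>+ z. ennreal (\<psi> z) * (\<integral>\<^sup>+ x. ennreal ((u x - u (z + a x))\<^sup>2) \<partial>lborel) \<partial>lborel)"
    by (intro nn_integral_cong nn_integral_cmult) simp
  finally show ?thesis .
qed

text \<open>Both halves of the theorem are instances, with \<open>s = sqrt M\<close> below
  \<open>1\<close> and \<open>s = sqrt m\<close> above \<open>1\<close>; the square
  \<open>(1 - s)\<^sup>2\<close> hides the sign.\<close>

lemma first_eigenvalue_ge:
  fixes \<psi> :: "real ^ 'n \<Rightarrow> real" and a :: "real ^ 'n \<Rightarrow> real ^ 'n"
  assumes nonneg: "\<And>x. 0 \<le> \<psi> x"
    and \<psi>: "\<psi> \<in> borel_measurable lebesgue"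
    and a: "diffeomorphism a"
    and K: "\<And>x y. K x y = \<psi> (y - a x) + \<psi> (x - a y)"
    and "0 < s"
    and J: "s \<le> 1 \<and> (\<forall>y. \<bar>jacobian_det (inv a) y\<bar> \<le> s\<^sup>2) \<or>
      1 \<le> s \<and> (\<forall>y. s\<^sup>2 \<le> \<bar>jacobian_det (inv a) y\<bar>)"
  shows "ennreal (2 * (1 - s)\<^sup>2 * (\<integral> x. \<psi> x \<partial>lebesgue)) \<le> first_eigenvalue K"
  unfolding first_eigenvalue_def
proof (rule INF_greatest)
  fix u :: "real ^ 'n \<Rightarrow> real"
  assume "u \<in> {u \<in> L2. \<not> (AE x in lebesgue. u x = 0)}"
  then have u: "u \<in> borel_measurable lebesgue" "integrable lebesgue (\<lambda>x. (u x)\<^sup>2)"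
      and nz: "\<not> (AE x in lebesgue. u x = 0)"
    by (auto simp: L2_def)
  note [measurable] = diffeomorphism_borel_measurable[OF a] jacobian_det_inv_borel_measurable[OF a]
  let ?J = "\<lambda>y. \<bar>jacobian_det (inv a) y\<bar>"
  define p where "p = (\<integral> x. (u x)\<^sup>2 \<partial>lebesgue)"
  have "p \<noteq> 0"
    unfolding p_def using nz by (subst integral_nonneg_eq_0_iff_AE) (auto simp: u)
  moreover have "0 \<le> p"
    unfolding p_def by simp
  ultimately have p: "0 < p"
    by simp
  obtain \<psi>0 where \<psi>0: "\<psi>0 \<in> borel_measurable lborel" "AE x in lborel. \<psi> x = \<psi>0 x"
    using completion_ex_borel_measurable_real[OF \<psi>] by blast
  \<comment> \<open>The representative \<open>\<psi>0\<close> may be negative on a null set.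
    Truncation makes it nonnegative everywhere and keeps it equal to \<psi> almost
    everywhere.\<close>
  define \<psi>' where "\<psi>' = (\<lambda>x. max 0 (\<psi>0 x))"
  have \<psi>'_AE: "AE x in lborel. \<psi> x = \<psi>' x"
    using \<psi>0(2) by eventually_elim (simp add: \<psi>'_def max_def, metis nonneg)
  have \<psi>'_nonneg: "0 \<le> \<psi>' x" for x
    by (simp add: \<psi>'_def)
  have [measurable]: "\<psi>' \<in> borel_measurable borel"
    using \<psi>0(1) unfolding \<psi>'_def by simp
  obtain v where "v \<in> borel_measurable lborel" and v_AE: "AE x in lborel. u x = v x"
    using completion_ex_borel_measurable_real[OF u(1)] by blast
  then have [measurable]: "v \<in> borel_measurable borel"
    by simp
  have v2: "(\<integral>\<^sup>+ x. ennreal ((v x)\<^sup>2) \<partial>lborel) = ennreal p"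
  proof -
    have "(\<integral>\<^sup>+ x. ennreal ((v x)\<^sup>2) \<partial>lborel) = (\<integral>\<^sup>+ x. ennreal ((u x)\<^sup>2) \<partial>lebesgue)"
      unfolding nn_integral_completion
      by (rule nn_integral_cong_AE) (use v_AE in eventually_elim, simp)
    then show ?thesis
      unfolding p_def by (simp add: nn_integral_eq_integral u)
  qed
  \<comment> \<open>\<open>P\<close> and \<open>Q\<close> write both squared norms as integrals
    against the same function of \<open>y\<close>, so the pointwise bound on the Jacobian compares
    the integrands.\<close>
  have lower: "ennreal ((1 - s)\<^sup>2 * p) \<le> (\<integral>\<^sup>+ x. ennreal ((v x - v (z + a x))\<^sup>2) \<partial>lborel)" for z
  proof -
    have Q: "(\<integral>\<^sup>+ x. ennreal ((v (z + a x))\<^sup>2) \<partial>lborel)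
        = (\<integral>\<^sup>+ y. ennreal (?J y) * ennreal ((v (z + y))\<^sup>2) \<partial>lborel)"
      by (rule nn_integral_diffeomorphism[OF a]) simp
    have P: "ennreal (s\<^sup>2) * ennreal p = (\<integral>\<^sup>+ y. ennreal (s\<^sup>2) * ennreal ((v (z + y))\<^sup>2) \<partial>lborel)"
      using nn_integral_lborel_translation[of "\<lambda>x. ennreal ((v x)\<^sup>2)" z]
      by (simp add: nn_integral_cmult v2)
    have "ennreal ((1 - s)\<^sup>2) * (\<integral>\<^sup>+ x. ennreal ((v x)\<^sup>2) \<partial>lborel)
        \<le> (\<integral>\<^sup>+ x. ennreal ((v x - v (z + a x))\<^sup>2) \<partial>lborel)"
      by (rule nn_integral_power2_diff_ge[OF _ _ _ \<open>0 < s\<close>])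
        (use J in \<open>auto simp: v2 P Q intro!: nn_integral_mono mult_right_mono ennreal_leI\<close>)
    then show ?thesis
      by (simp add: v2 ennreal_mult')
  qed
  have \<psi>'_transl: "AE x in lborel. \<psi> (x - y) = \<psi>' (x - y)" for y
    using AE_distrD[of "\<lambda>x. x - y" lborel borel "\<lambda>x. \<psi> x = \<psi>' x"] \<psi>'_AE
    unfolding distr_lborel_minus_const by simp
  \<comment> \<open>The exceptional null set is reflected by \<open>y - x\<close> and then pulled
    back along \<open>a\<close>; both operations keep it null.\<close>
  have \<psi>'_a: "AE x in lborel. \<psi> (y - a x) = \<psi>' (y - a x)" for y
    using AE_distrD[of "\<lambda>x. y - x" lborel borel "\<lambda>x. \<psi> x = \<psi>' x"] \<psi>'_AE
    unfolding distr_lborel_const_minus by (intro AE_lborel_diffeomorphism[OF a]) simp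
  have "(\<integral>\<^sup>+ y. (\<integral>\<^sup>+ x. ennreal (K x y * (u x - u y)\<^sup>2) \<partial>lebesgue) \<partial>lebesgue)
      = (\<integral>\<^sup>+ y. (\<integral>\<^sup>+ x. ennreal ((\<psi>' (y - a x) + \<psi>' (x - a y)) * (v x - v y)\<^sup>2) \<partial>lborel) \<partial>lborel)"
    unfolding nn_integral_completion
  proof (rule nn_integral_cong_AE, use v_AE in eventually_elim)
    fix y assume y: "u y = v y"
    show "(\<integral>\<^sup>+ x. ennreal (K x y * (u x - u y)\<^sup>2) \<partial>lborel)
        = (\<integral>\<^sup>+ x. ennreal ((\<psi>' (y - a x) + \<psi>' (x - a y)) * (v x - v y)\<^sup>2) \<partial>lborel)"
      by (rule nn_integral_cong_AE, use v_AE \<psi>'_transl[of "a y"] \<psi>'_a[of y] in eventually_elim)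
        (simp add: K y)
  qed
  also have "\<dots> = 2 * (\<integral>\<^sup>+ z. ennreal (\<psi>' z) * (\<integral>\<^sup>+ x. ennreal ((v x - v (z + a x))\<^sup>2) \<partial>lborel) \<partial>lborel)"
    by (rule nn_integral_kernel_eq) (auto simp: \<psi>'_nonneg)
  finally have E: "(\<integral>\<^sup>+ y. (\<integral>\<^sup>+ x. ennreal (K x y * (u x - u y)\<^sup>2) \<partial>lebesgue) \<partial>lebesgue) = \<dots>" .
  \<comment> \<open>The Bochner integral defaults to \<open>0\<close> when \<psi> is not integrable,
    so the inequality holds in either case.\<close>
  have "ennreal (\<integral> x. \<psi> x \<partial>lebesgue) \<le> (\<integral>\<^sup>+ x. ennreal (\<psi> x) \<partial>lebesgue)"
    by (cases "integrable lebesgue \<psi>")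
      (auto simp: nn_integral_eq_integral nonneg not_integrable_integral_eq)
  also have "\<dots> = (\<integral>\<^sup>+ x. ennreal (\<psi>' x) \<partial>lborel)"
    unfolding nn_integral_completion
    by (rule nn_integral_cong_AE) (use \<psi>'_AE in eventually_elim, simp)
  finally have int: "ennreal (\<integral> x. \<psi> x \<partial>lebesgue) \<le> (\<integral>\<^sup>+ x. ennreal (\<psi>' x) \<partial>lborel)" .
  have "ennreal (2 * (1 - s)\<^sup>2 * (\<integral> x. \<psi> x \<partial>lebesgue)) * ennreal p
      = 2 * (ennreal (\<integral> x. \<psi> x \<partial>lebesgue) * ennreal ((1 - s)\<^sup>2 * p))"
    using p nonneg by (simp add: ennreal_mult mult_ac)
  also have "\<dots> \<le> 2 * ((\<integral>\<^sup>+ z. ennreal (\<psi>' z) \<partial>lborel) * ennreal ((1 - s)\<^sup>2 * p))"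
    by (intro mult_left_mono mult_right_mono int) auto
  also have "\<dots> = 2 * (\<integral>\<^sup>+ z. ennreal (\<psi>' z) * ennreal ((1 - s)\<^sup>2 * p) \<partial>lborel)"
    by (simp add: nn_integral_multc)
  also have "\<dots> \<le> 2 * (\<integral>\<^sup>+ z. ennreal (\<psi>' z) * (\<integral>\<^sup>+ x. ennreal ((v x - v (z + a x))\<^sup>2) \<partial>lborel) \<partial>lborel)"
    by (intro mult_left_mono nn_integral_mono lower) auto
  finally have "ennreal (2 * (1 - s)\<^sup>2 * (\<integral> x. \<psi> x \<partial>lebesgue)) * ennreal p / ennreal p
      \<le> (\<integral>\<^sup>+ y. (\<integral>\<^sup>+ x. ennreal (K x y * (u x - u y)\<^sup>2) \<partial>lebesgue) \<partial>lebesgue) / ennreal p"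
    unfolding E by (rule divide_right_mono_ennreal)
  then show "ennreal (2 * (1 - s)\<^sup>2 * (\<integral> x. \<psi> x \<partial>lebesgue))
      \<le> (\<integral>\<^sup>+ y. (\<integral>\<^sup>+ x. ennreal (K x y * (u x - u y)\<^sup>2) \<partial>lebesgue) \<partial>lebesgue)
        / ennreal (\<integral> x. (u x)\<^sup>2 \<partial>lebesgue)"
    using p by (simp add: ennreal_mult_divide_eq flip: p_def)
qed

theorem theorem1p2:
  fixes \<psi> :: "real ^ 'n \<Rightarrow> real"
    and a :: "real ^ 'n \<Rightarrow> real ^ 'n"
    and K :: "real ^ 'n \<Rightarrow> real ^ 'n \<Rightarrow> real"
    and M m :: real
  assumes "\<And>x. 0 \<le> \<psi> x"
    and "bounded (range \<psi>)"
    and "\<psi> \<in> borel_measurable lebesgue"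
    and "\<And>x. x \<notin> cball 0 1 \<Longrightarrow> \<psi> x = 0"
    and "diffeomorphism a"
    and "\<And>x y. K x y = \<psi> (y - a x) + \<psi> (x - a y)"
  shows "((SUP x. ereal \<bar>jacobian_det (inv a) x\<bar>) = ereal M \<and> M < 1 \<longrightarrow>
            first_eigenvalue K \<ge> ennreal (2 * (1 - sqrt M)\<^sup>2 * (\<integral> x. \<psi> x \<partial>lebesgue))) \<and>
         ((INF x. ereal \<bar>jacobian_det (inv a) x\<bar>) = ereal m \<and> m > 1 \<longrightarrow>
            first_eigenvalue K \<ge> ennreal (2 * (sqrt m - 1)\<^sup>2 * (\<integral> x. \<psi> x \<partial>lebesgue)))"
proof (intro conjI impI; elim conjE)
  let ?J = "\<lambda>x. \<bar>jacobian_det (inv a) x\<bar>"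
  note ge = first_eigenvalue_ge[OF assms(1,3,5,6)]
  show "ennreal (2 * (1 - sqrt M)\<^sup>2 * (\<integral> x. \<psi> x \<partial>lebesgue)) \<le> first_eigenvalue K"
    if M: "(SUP x. ereal (?J x)) = ereal M" "M < 1"
  proof -
    have le: "?J x \<le> M" for x
      using SUP_upper[of x UNIV "\<lambda>x. ereal (?J x)"] M(1) by simp
    \<comment> \<open>A nonzero Jacobian at a single point already makes \<open>M\<close> positive,
      so \<open>sqrt M\<close> is admissible as \<open>s\<close>.\<close>
    have "0 < M"
      using le[of 0] jacobian_det_inv_nonzero[OF assms(5), of 0] by linarith
    then show ?thesis
      by (intro ge) (use M(2) le in auto)
  qed
  show "ennreal (2 * (sqrt m - 1)\<^sup>2 * (\<integral> x. \<psi> x \<partial>lebesgue)) \<le> first_eigenvalue K"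
    if m: "(INF x. ereal (?J x)) = ereal m" "1 < m"
  proof -
    have ge_m: "m \<le> ?J x" for x
      using INF_lower[of x UNIV "\<lambda>x. ereal (?J x)"] m(1) by simp
    have "ennreal (2 * (1 - sqrt m)\<^sup>2 * (\<integral> x. \<psi> x \<partial>lebesgue)) \<le> first_eigenvalue K"
      by (intro ge) (use m(2) ge_m in auto)
    then show ?thesis
      by (simp add: power2_commute)
  qed
qed

end
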